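(* Let $G_w$ be a weighted bicyclic graph. Then $i_-(G_w)=1$ if and only if $G_w$ is (isomorphic as a weighted graph to) $\theta(1,1,1)_w$ with weights satisfying $c_1a_2=a_1c_2$ and $a_2b_1=a_1b_2$.
   Context: A weighted graph is a simple graph with a positive weight on each edge; its adjacency matrix has entry $w(xy)$ if $xy$ is an edge and $0$ otherwise, and $i_-(G_w)$ is the number of negative eigenvalues of this matrix, with multiplicity. A bicyclic graph is a connected simple graph with $|E|=|V|+1$. $\theta(1,1,1)_w$ is the weighted graph with vertices $u,v,x_1,y_1,z_1$ and edges $ux_1,x_1v,uy_1,y_1v,uz_1,z_1v$ with positive weights $w(ux_1)=a_1$, $w(x_1v)=a_2$, $w(uy_1)=b_1$, $w(y_1v)=b_2$, $w(uz_1)=c_1$, $w(z_1v)=c_2$. *)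

theory Defs
  imports
    "Graph_Theory.Digraph_Component"
    "Graph_Theory.Pair_Digraph"
    "Jordan_Normal_Form.Char_Poly"
begin

text \<open>
  Finite simple graphs are the finite, symmetric, loop-free digraphs without parallel arcs of
  the locale \<open>pair_graph\<close>. An undirected edge \<open>xy\<close> is a pair of arcs \<open>(x, y)\<close>, \<open>(y, x)\<close> there, so
  edges are counted, and carry their weights, as two-element sets.
\<close>

definition edges :: "'a pair_pre_digraph \<Rightarrow> 'a set set" where
  "edges G = {{x, y} | x y. (x, y) \<in> parcs G}"

definition bicyclic :: "'a pair_pre_digraph \<Rightarrow> bool" where
  "bicyclic G \<longleftrightarrow>
     pair_graph G \<and> connected (with_proj G) \<and> card (edges G) = card (pverts G) + 1"

text \<open>The values of a weight function outside the edges are irrelevant.\<close>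

definition weighted_graph :: "'a pair_pre_digraph \<Rightarrow> ('a set \<Rightarrow> real) \<Rightarrow> bool" where
  "weighted_graph G w \<longleftrightarrow> pair_graph G \<and> (\<forall>e\<in>edges G. w e > 0)"

definition weighted_iso ::
  "'a pair_pre_digraph \<Rightarrow> ('a set \<Rightarrow> real) \<Rightarrow> 'b pair_pre_digraph \<Rightarrow> ('b set \<Rightarrow> real) \<Rightarrow> bool" where
  "weighted_iso G w H w' \<longleftrightarrow>
     (\<exists>f. bij_betw f (pverts G) (pverts H) \<and>
          (\<forall>x\<in>pverts G. \<forall>y\<in>pverts G. (x, y) \<in> parcs G \<longleftrightarrow> (f x, f y) \<in> parcs H) \<and>
          (\<forall>x y. (x, y) \<in> parcs G \<longrightarrow> w {x, y} = w' {f x, f y}))"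

definition adjacency_matrix :: "'a pair_pre_digraph \<Rightarrow> ('a set \<Rightarrow> real) \<Rightarrow> 'a list \<Rightarrow> real mat" where
  "adjacency_matrix G w vs =
     mat (length vs) (length vs)
       (\<lambda>(i, j). if (vs ! i, vs ! j) \<in> parcs G then w {vs ! i, vs ! j} else 0)"

text \<open>
  The eigenvalues of a real symmetric matrix are real; the multiplicity is the algebraic one,
  i.e. the multiplicity as a root of the characteristic polynomial.
\<close>

definition num_neg_eigenvalues :: "real mat \<Rightarrow> nat" where
  "num_neg_eigenvalues A = (\<Sum>x | eigenvalue A x \<and> x < 0. order x (char_poly A))"

text \<open>
  The vertices have to be listed in some order to obtain a matrix. The choice of the order is
  immaterial, see lemma \<open>neg_index_eq\<close> below.
\<close>

definition neg_index :: "'a pair_pre_digraph \<Rightarrow> ('a set \<Rightarrow> real) \<Rightarrow> nat" where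
  "neg_index G w =
     num_neg_eigenvalues (adjacency_matrix G w (SOME vs. distinct vs \<and> set vs = pverts G))"

lemma char_poly_adjacency_matrix_eq:
  assumes "distinct us" "distinct vs" "set us = set vs"
  shows "char_poly (adjacency_matrix G w us) = char_poly (adjacency_matrix G w vs)"
proof -
  define n where "n = length us"
  have n: "length us = n" "length vs = n"
    using assms distinct_card[of us] distinct_card[of vs] by (simp_all add: n_def)
  define P where "P = mat n n (\<lambda>(i, j). if us ! i = vs ! j then 1 else 0 :: real)"
  define Q where "Q = mat n n (\<lambda>(i, j). if vs ! i = us ! j then 1 else 0 :: real)"
  have "\<forall>i<n. \<exists>k. k < n \<and> vs ! k = us ! i"
    using assms(3) n nth_mem[of _ us] by (auto simp: in_set_conv_nth)
  then obtain p where p: "\<And>i. i < n \<Longrightarrow> p i < n \<and> vs ! p i = us ! i"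
    by metis
  have "\<forall>i<n. \<exists>k. k < n \<and> us ! k = vs ! i"
    using assms(3) n nth_mem[of _ vs] by (auto simp: in_set_conv_nth)
  then obtain q where q: "\<And>i. i < n \<Longrightarrow> q i < n \<and> us ! q i = vs ! i"
    by metis
  have P: "P $$ (i, j) = (if j = p i then 1 else 0)" if "i < n" "j < n" for i j
    using that p[OF that(1)] assms(2) n by (auto simp: P_def nth_eq_iff_index_eq)
  have Q: "Q $$ (i, j) = (if j = q i then 1 else 0)" if "i < n" "j < n" for i j
    using that q[OF that(1)] assms(1) n by (auto simp: Q_def nth_eq_iff_index_eq)
  have Q': "Q $$ (i, j) = (if i = p j then 1 else 0)" if "i < n" "j < n" for i j
    using that p[OF that(2)] nth_eq_iff_index_eq[OF assms(2), of i "p j"] n by (simp add: Q_def)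
  have qp: "q (p i) = i" "p (q i) = i" if "i < n" for i
    using that p[of i] q[of "p i"] q[of i] p[of "q i"] assms(1,2) n
    by (auto simp: nth_eq_iff_index_eq)
  have dims: "P \<in> carrier_mat n n" "Q \<in> carrier_mat n n"
    "adjacency_matrix G w us \<in> carrier_mat n n" "adjacency_matrix G w vs \<in> carrier_mat n n"
    by (auto simp: P_def Q_def adjacency_matrix_def n)
  have Pm: "(P * A) $$ (i, j) = A $$ (p i, j)" if "A \<in> carrier_mat n n" "i < n" "j < n" for A i j
  proof -
    have "(P * A) $$ (i, j) = (\<Sum>k = 0..<n. P $$ (i, k) * A $$ (k, j))"
      using that dims by (auto simp: scalar_prod_def)
    also have "\<dots> = (\<Sum>k = 0..<n. if k = p i then A $$ (k, j) else 0)"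
      by (rule sum.cong) (use that P in auto)
    finally show ?thesis using p[OF that(2)] by simp
  qed
  have Qm: "(Q * A) $$ (i, j) = A $$ (q i, j)" if "A \<in> carrier_mat n n" "i < n" "j < n" for A i j
  proof -
    have "(Q * A) $$ (i, j) = (\<Sum>k = 0..<n. Q $$ (i, k) * A $$ (k, j))"
      using that dims by (auto simp: scalar_prod_def)
    also have "\<dots> = (\<Sum>k = 0..<n. if k = q i then A $$ (k, j) else 0)"
      by (rule sum.cong) (use that Q in auto)
    finally show ?thesis using q[OF that(2)] by simp
  qed
  have mQ: "(A * Q) $$ (i, j) = A $$ (i, p j)" if "A \<in> carrier_mat n n" "i < n" "j < n" for A i j
  proof -
    have "(A * Q) $$ (i, j) = (\<Sum>k = 0..<n. A $$ (i, k) * Q $$ (k, j))"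
      using that dims by (auto simp: scalar_prod_def)
    also have "\<dots> = (\<Sum>k = 0..<n. if k = p j then A $$ (i, k) else 0)"
      by (rule sum.cong) (use that Q' in auto)
    finally show ?thesis using p[OF that(3)] by simp
  qed
  have "P * Q = 1\<^sub>m n"
  proof (rule eq_matI)
    fix i j assume ij: "i < dim_row (1\<^sub>m n :: real mat)" "j < dim_col (1\<^sub>m n :: real mat)"
    then show "(P * Q) $$ (i, j) = 1\<^sub>m n $$ (i, j)"
      using Pm[OF dims(2), of i j] Q[of "p i" j] p[of i] qp(1)[of i] by auto
  qed (use dims in auto)
  moreover have "Q * P = 1\<^sub>m n"
  proof (rule eq_matI)
    fix i j assume ij: "i < dim_row (1\<^sub>m n :: real mat)" "j < dim_col (1\<^sub>m n :: real mat)"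
    then show "(Q * P) $$ (i, j) = 1\<^sub>m n $$ (i, j)"
      using Qm[OF dims(1), of i j] P[of "q i" j] q[of i] qp(2)[of i] by auto
  qed (use dims in auto)
  moreover have "adjacency_matrix G w us = P * adjacency_matrix G w vs * Q"
  proof (rule eq_matI)
    fix i j assume "i < dim_row (P * adjacency_matrix G w vs * Q)" "j < dim_col (P * adjacency_matrix G w vs * Q)"
    then have ij: "i < n" "j < n" using dims by auto
    have "(P * adjacency_matrix G w vs * Q) $$ (i, j) = adjacency_matrix G w vs $$ (p i, p j)"
      using mQ[of "P * adjacency_matrix G w vs" i j] Pm[OF dims(4), of i "p j"] p ij dims by auto
    then show "adjacency_matrix G w us $$ (i, j) = (P * adjacency_matrix G w vs * Q) $$ (i, j)"
      using p ij by (simp add: adjacency_matrix_def n)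
  qed (use dims in auto)
  ultimately have "similar_mat_wit (adjacency_matrix G w us) (adjacency_matrix G w vs) P Q"
    using dims by (auto simp: similar_mat_wit_def Let_def)
  then show ?thesis
    by (intro char_poly_similar) (auto simp: similar_mat_def)
qed

lemma neg_index_eq:
  assumes "distinct vs" "set vs = pverts G"
  shows "neg_index G w = num_neg_eigenvalues (adjacency_matrix G w vs)"
proof -
  define us where "us = (SOME us. distinct us \<and> set us = pverts G)"
  have us: "distinct us \<and> set us = pverts G"
    unfolding us_def by (rule someI[of _ vs]) (use assms in auto)
  have c: "adjacency_matrix G w xs \<in> carrier_mat (length xs) (length xs)" for xs
    by (auto simp: adjacency_matrix_def)
  show ?thesis
    unfolding neg_index_def us_def[symmetric] num_neg_eigenvalues_def
      eigenvalue_root_char_poly[OF c]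
    using char_poly_adjacency_matrix_eq[of us vs G w] us assms by simp
qed

datatype theta_vertex = Vu | Vv | Vx1 | Vy1 | Vz1

definition theta111 :: "theta_vertex pair_pre_digraph" where
  "theta111 =
     (let A = {(Vu, Vx1), (Vx1, Vv), (Vu, Vy1), (Vy1, Vv), (Vu, Vz1), (Vz1, Vv)}
      in \<lparr>pverts = {Vu, Vv, Vx1, Vy1, Vz1}, parcs = A \<union> A\<inverse>\<rparr>)"

definition theta111_weight ::
  "real \<Rightarrow> real \<Rightarrow> real \<Rightarrow> real \<Rightarrow> real \<Rightarrow> real \<Rightarrow> theta_vertex set \<Rightarrow> real" where
  "theta111_weight a1 a2 b1 b2 c1 c2 e =
     (if e = {Vu, Vx1} then a1 else if e = {Vx1, Vv} then a2
      else if e = {Vu, Vy1} then b1 else if e = {Vy1, Vv} then b2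
      else if e = {Vu, Vz1} then c1 else if e = {Vz1, Vv} then c2 else 0)"

end

theory Submission
  imports Defs "Jordan_Normal_Form.Spectral_Radius"
begin

text \<open>
  By the spectral theorem, a symmetric matrix has exactly one negative eigenvalue iff its quadratic
  form takes a negative value but is nonnegative on some hyperplane; in particular it is then not
  negative definite on any plane. A triangle carries a negative definite plane, and so does every
  set \<open>{p, q, r, s}\<close> with \<open>p, q\<close> and \<open>r, s\<close> nonadjacent whose \<open>2 \<times> 2\<close> weight matrix between
  \<open>{p, q}\<close> and \<open>{r, s}\<close> is nonsingular. For an edge \<open>uv\<close> of a connected graph without such subsets,
  the neighbourhoods of \<open>v\<close> and \<open>u\<close> therefore are the classes of a complete bipartite graph.
  Counting edges, \<open>m n = m + n + 1\<close>, leaves only \<open>K\<^sub>2\<^sub>,\<^sub>3 = \<theta>(1,1,1)\<close>, and singularity of its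
  \<open>2 \<times> 2\<close> blocks is the stated condition on the weights. Conversely, under this condition the form
  is a positive multiple of a product of two linear forms in disjoint sets of variables.
\<close>

subsection \<open>Orthogonal diagonalization of real symmetric matrices\<close>

lemma scalar_prod_self_eq_0_iff:
  fixes v :: "real vec"
  shows "v \<bullet> v = 0 \<longleftrightarrow> v = 0\<^sub>v (dim_vec v)"
proof
  assume "v \<bullet> v = 0"
  then have "(\<Sum>i = 0..<dim_vec v. v $ i * v $ i) = 0" by (simp add: scalar_prod_def)
  then have "\<forall>i\<in>{0..<dim_vec v}. v $ i * v $ i = 0"
    by (subst (asm) sum_nonneg_eq_0_iff) auto
  then show "v = 0\<^sub>v (dim_vec v)" by auto
next
  assume "v = 0\<^sub>v (dim_vec v)"
  then have "\<And>i. i < dim_vec v \<Longrightarrow> v $ i = 0" by (metis index_zero_vec(1))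
  then show "v \<bullet> v = 0" by (simp add: scalar_prod_def)
qed

lemma scalar_prod_self_nonneg:
  fixes v :: "real vec"
  shows "v \<bullet> v \<ge> 0"
  by (auto simp: scalar_prod_def intro!: sum_nonneg)

lemma symmetric_scalar_prod:
  fixes A :: "'a :: comm_semiring_0 mat"
  assumes "A \<in> carrier_mat n n" "transpose_mat A = A" "x \<in> carrier_vec n" "y \<in> carrier_vec n"
  shows "y \<bullet> (A *\<^sub>v x) = x \<bullet> (A *\<^sub>v y)"
proof -
  have "y \<bullet> (A *\<^sub>v x) = (A *\<^sub>v y) \<bullet> x"
    using transpose_vec_mult_scalar[of A n n x y] assms by simp
  also have "\<dots> = x \<bullet> (A *\<^sub>v y)"
    using assms by (intro comm_scalar_prod[of _ n]) auto
  finally show ?thesis .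
qed

text \<open>For \<open>n > 0\<close> there is a complex eigenvector with real part \<open>x\<close>
  and imaginary part \<open>y\<close>. Symmetry of \<open>A\<close> forces its eigenvalue to be
  real, and then \<open>x\<close> or \<open>y\<close>, whichever is nonzero, is a real
  eigenvector.\<close>

lemma symmetric_real_eigenvector:
  fixes A :: "real mat"
  assumes A: "A \<in> carrier_mat n n" and sym: "transpose_mat A = A" and n: "n > 0"
  obtains v e where "v \<in> carrier_vec n" "v \<noteq> 0\<^sub>v n" "A *\<^sub>v v = e \<cdot>\<^sub>v v"
proof -
  define B where "B = map_mat complex_of_real A"
  have B: "B \<in> carrier_mat n n" using A by (simp add: B_def)
  from spectrum_non_empty[OF B n] obtain k z where z: "z \<in> carrier_vec n" "z \<noteq> 0\<^sub>v n"
    and Bz: "B *\<^sub>v z = k \<cdot>\<^sub>v z"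
    using B unfolding spectrum_def eigenvalue_def eigenvector_def by auto
  define x where "x = map_vec Re z"
  define y where "y = map_vec Im z"
  have xy: "x \<in> carrier_vec n" "y \<in> carrier_vec n" using z by (auto simp: x_def y_def)
  have eq: "(\<Sum>j = 0..<n. complex_of_real (A $$ (i, j)) * z $ j) = k * z $ i" if "i < n" for i
  proof -
    have "(B *\<^sub>v z) $ i = (k \<cdot>\<^sub>v z) $ i" using Bz by simp
    then show ?thesis using that z A by (simp add: B_def scalar_prod_def)
  qed
  have Ax: "A *\<^sub>v x = Re k \<cdot>\<^sub>v x - Im k \<cdot>\<^sub>v y"
  proof (rule eq_vecI)
    fix i assume "i < dim_vec (Re k \<cdot>\<^sub>v x - Im k \<cdot>\<^sub>v y)"
    then have i: "i < n" using xy by simp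
    show "(A *\<^sub>v x) $ i = (Re k \<cdot>\<^sub>v x - Im k \<cdot>\<^sub>v y) $ i"
      using arg_cong[OF eq[OF i], of Re] i xy z A by (simp add: scalar_prod_def x_def y_def)
  qed (use A xy in auto)
  have Ay: "A *\<^sub>v y = Im k \<cdot>\<^sub>v x + Re k \<cdot>\<^sub>v y"
  proof (rule eq_vecI)
    fix i assume "i < dim_vec (Im k \<cdot>\<^sub>v x + Re k \<cdot>\<^sub>v y)"
    then have i: "i < n" using xy by simp
    show "(A *\<^sub>v y) $ i = (Im k \<cdot>\<^sub>v x + Re k \<cdot>\<^sub>v y) $ i"
      using arg_cong[OF eq[OF i], of Im] i xy z A by (simp add: scalar_prod_def x_def y_def)
  qed (use A xy in auto)
  have ne: "x \<noteq> 0\<^sub>v n \<or> y \<noteq> 0\<^sub>v n"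
  proof (rule ccontr)
    assume "\<not> ?thesis"
    then have "x $ i = 0" "y $ i = 0" if "i < n" for i using that by auto
    then have "z = 0\<^sub>v n" using z by (intro eq_vecI complex_eqI) (auto simp: x_def y_def)
    then show False using z by simp
  qed
  \<comment> \<open>After inserting \<open>Ax\<close> and \<open>Ay\<close> into this identity, the
    terms with \<open>Re k\<close> cancel and those with \<open>Im k\<close> add up to a multiple of
    the positive number \<open>x \<bullet> x + y \<bullet> y\<close>.\<close>
  have "y \<bullet> (A *\<^sub>v x) = x \<bullet> (A *\<^sub>v y)" using symmetric_scalar_prod[OF A sym xy] .
  moreover have "y \<bullet> (A *\<^sub>v x) = Re k * (y \<bullet> x) - Im k * (y \<bullet> y)"
    unfolding Ax using xy by (subst scalar_prod_minus_distrib[of _ n]) auto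
  moreover have "x \<bullet> (A *\<^sub>v y) = Im k * (x \<bullet> x) + Re k * (x \<bullet> y)"
    unfolding Ay using xy by (subst scalar_prod_add_distrib[of _ n]) auto
  moreover have "x \<bullet> y = y \<bullet> x" using xy by (rule comm_scalar_prod)
  ultimately have "Im k * (x \<bullet> x + y \<bullet> y) = 0" by (simp add: algebra_simps)
  moreover have "x \<bullet> x + y \<bullet> y \<noteq> 0"
    using ne xy scalar_prod_self_nonneg[of x] scalar_prod_self_nonneg[of y]
      scalar_prod_self_eq_0_iff[of x] scalar_prod_self_eq_0_iff[of y]
    by (metis add_nonneg_eq_0_iff carrier_vecD)
  ultimately have "Im k = 0" by simp
  then have "A *\<^sub>v x = Re k \<cdot>\<^sub>v x" "A *\<^sub>v y = Re k \<cdot>\<^sub>v y"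
    using Ax Ay xy by auto
  with ne xy that show thesis by blast
qed

text \<open>The reflection exchanging the first unit vector with the normalized \<open>v\<close> has
  these properties. Conjugation by it turns an eigenvector \<open>v\<close> into a unit vector,
  which drives the induction for the diagonalization.\<close>

lemma householder:
  fixes v :: "real vec"
  assumes v: "v \<in> carrier_vec n" "v \<noteq> 0\<^sub>v n" and n: "n > 0"
  obtains H c where "H \<in> carrier_mat n n" "transpose_mat H = H" "H * H = 1\<^sub>m n"
    "H *\<^sub>v unit_vec n 0 = c \<cdot>\<^sub>v v"
proof -
  define s where "s = v \<bullet> v"
  have s: "s > 0"
    using v scalar_prod_self_nonneg[of v] scalar_prod_self_eq_0_iff[of v] by (auto simp: s_def)
  define c where "c = 1 / sqrt s"
  define f where "f i = c * v $ i" for i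
  define u where "u i = f i - (if i = 0 then 1 else 0)" for i :: nat
  have f1: "(\<Sum>i<n. f i * f i) = 1"
  proof -
    have "(\<Sum>i<n. f i * f i) = c\<^sup>2 * s"
      using v by (simp add: f_def s_def scalar_prod_def sum_distrib_left power2_eq_square mult_ac
          lessThan_atLeast0)
    then show ?thesis using s by (simp add: c_def power_divide)
  qed
  define t where "t = (\<Sum>i<n. u i * u i)"
  \<comment> \<open>As \<open>f\<close> has length 1, its squared distance to the first unit vector
    is \<open>2 - 2 * f 0\<close>. For \<open>t \<noteq> 0\<close> this makes
    \<open>r * u i * u 0 = - u i\<close>, so column 0 of \<open>H\<close> becomes
    \<open>f\<close>.\<close>
  have t: "t = - 2 * u 0"
  proof -
    have "t = (\<Sum>i<n. f i * f i) - 2 * (\<Sum>i<n. if i = 0 then f i else 0)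
        + (\<Sum>i<n. if i = 0 then 1 else 0)"
      unfolding t_def sum_distrib_left sum_subtractf[symmetric] sum.distrib[symmetric]
      by (rule sum.cong) (auto simp: u_def algebra_simps)
    also have "\<dots> = 2 - 2 * f 0" using n f1 by (subst sum.delta, simp, subst sum.delta, auto)
    finally show ?thesis by (simp add: u_def)
  qed
  \<comment> \<open>\<open>H\<close> below is the reflection along \<open>u\<close>; if \<open>u = 0\<close>, then \<open>r = 2 / 0 = 0\<close> and \<open>H = 1\<close>.\<close>
  define r where "r = 2 / t"
  define H where "H = mat n n (\<lambda>(i, j). (if i = j then 1 else 0) - r * u i * u j)"
  have Hi: "H $$ (i, j) = (if i = j then 1 else 0) - r * u i * u j" if "i < n" "j < n" for i j
    using that by (simp add: H_def)
  have H: "H \<in> carrier_mat n n" by (simp add: H_def)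
  have "transpose_mat H = H" by (rule eq_matI) (auto simp: H_def)
  moreover have "H * H = 1\<^sub>m n"
  proof (rule eq_matI)
    fix i j assume "i < dim_row (1\<^sub>m n :: real mat)" "j < dim_col (1\<^sub>m n :: real mat)"
    then have ij: "i < n" "j < n" by auto
    have "(H * H) $$ (i, j) = (\<Sum>k<n. H $$ (i, k) * H $$ (k, j))"
      using ij H by (simp add: scalar_prod_def lessThan_atLeast0)
    also have "\<dots> = (\<Sum>k<n. (if k = i then (if i = j then 1 else 0) - r * u i * u j else 0)
        - (if k = j then r * u i * u j else 0) + r * r * u i * u j * (u k * u k))"
      by (rule sum.cong) (use ij in \<open>auto simp: Hi algebra_simps\<close>)
    also have "\<dots> = (if i = j then 1 else 0) - r * u i * u j - r * u i * u j
        + r * r * u i * u j * t"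
      using ij by (simp add: sum.distrib sum_subtractf t_def sum_distrib_left)
    also have "\<dots> = (if i = j then 1 else 0) + r * u i * u j * (r * t - 2)"
      by (simp add: algebra_simps)
    also have "r * u i * u j * (r * t - 2) = 0" by (simp add: r_def)
    finally show "(H * H) $$ (i, j) = 1\<^sub>m n $$ (i, j)" using ij by simp
  qed (use H in auto)
  moreover have "H *\<^sub>v unit_vec n 0 = c \<cdot>\<^sub>v v"
  proof (rule eq_vecI)
    fix i assume "i < dim_vec (c \<cdot>\<^sub>v v)"
    then have i: "i < n" using v by simp
    have "(H *\<^sub>v unit_vec n 0) $ i = H $$ (i, 0)"
      using i n H by simp
    also have "\<dots> = (if i = 0 then 1 else 0) + u i"
    proof (cases "t = 0")
      case True
      then have "\<forall>i\<in>{..<n}. u i * u i = 0"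
        unfolding t_def by (subst (asm) sum_nonneg_eq_0_iff) auto
      then show ?thesis using i n by (simp add: Hi True r_def)
    next
      case False
      then have "r * u i * u 0 = - u i" using t by (simp add: r_def)
      then show ?thesis using i n by (simp add: Hi)
    qed
    finally show "(H *\<^sub>v unit_vec n 0) $ i = (c \<cdot>\<^sub>v v) $ i" using i v by (simp add: u_def f_def)
  qed (use v H in auto)
  ultimately show thesis using that H by blast
qed

text \<open>Deflation: a reflection moves an eigenvector to the first unit vector. This clears the
  first column off the diagonal, by symmetry also the first row, and leaves a smaller symmetric
  block for the induction hypothesis.\<close>

theorem symmetric_real_diagonalization:
  fixes A :: "real mat"
  assumes "A \<in> carrier_mat n n" "transpose_mat A = A"
  obtains P d where "P \<in> carrier_mat n n" "transpose_mat P * P = 1\<^sub>m n" "P * transpose_mat P = 1\<^sub>m n"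
    "A = P * mat_diag n d * transpose_mat P"
proof -
  \<comment> \<open>The induction carries only one of the two orthogonality equations; a left
    inverse of a square matrix is a right inverse, which gives the other one at the end.\<close>
  have "\<exists>P d. P \<in> carrier_mat n n \<and> transpose_mat P * P = 1\<^sub>m n \<and>
    A = P * mat_diag n d * transpose_mat P"
    using assms
  proof (induction n arbitrary: A)
    case 0
    show ?case
      by (intro exI[of _ "1\<^sub>m 0"] exI[of _ "\<lambda>_. 0"]) (use 0 in auto)
  next
    case (Suc n)
    note A = Suc.prems(1) and sym = Suc.prems(2)
    from symmetric_real_eigenvector[OF A sym] obtain v e
      where v: "v \<in> carrier_vec (Suc n)" "v \<noteq> 0\<^sub>v (Suc n)" and Av: "A *\<^sub>v v = e \<cdot>\<^sub>v v" by auto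
    from householder[OF v] obtain H c where H: "H \<in> carrier_mat (Suc n) (Suc n)"
      and Hsym: "transpose_mat H = H" and HH: "H * H = 1\<^sub>m (Suc n)"
      and He: "H *\<^sub>v unit_vec (Suc n) 0 = c \<cdot>\<^sub>v v" by auto
    let ?e = "unit_vec (Suc n) 0 :: real vec"
    \<comment> \<open>\<open>H\<close> is its own inverse and its own transpose, so \<open>B\<close>
      is symmetric and similar to \<open>A\<close>.\<close>
    define B where "B = H * A * H"
    have B: "B \<in> carrier_mat (Suc n) (Suc n)" using H A by (simp add: B_def)
    have Bsym: "transpose_mat B = B"
      unfolding B_def using H A sym Hsym by (simp add: transpose_mult[of _ "Suc n" "Suc n" _ "Suc n"])
    have AB: "A = H * B * H"
    proof -
      have "H * B * H = (H * H) * A * (H * H)"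
        using H A by (simp add: B_def assoc_mult_mat[of _ "Suc n" "Suc n" _ "Suc n" _ "Suc n"])
      then show ?thesis using HH A by simp
    qed
    have "B *\<^sub>v ?e = H *\<^sub>v (A *\<^sub>v (H *\<^sub>v ?e))"
      unfolding B_def using H A by (simp add: assoc_mult_mat_vec[of _ "Suc n" "Suc n" _ "Suc n"])
    also have "\<dots> = e \<cdot>\<^sub>v (H *\<^sub>v (H *\<^sub>v ?e))"
      unfolding He using A H v Av by (simp add: mult_mat_vec[of _ "Suc n" "Suc n"] smult_smult_assoc mult.commute)
    also have "H *\<^sub>v (H *\<^sub>v ?e) = ?e"
      using H HH assoc_mult_mat_vec[OF H H, of ?e, symmetric] by simp
    finally have Be: "B *\<^sub>v ?e = e \<cdot>\<^sub>v ?e" .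
    have B0: "B $$ (i, 0) = (if i = 0 then e else 0)" if "i < Suc n" for i
    proof -
      have "B $$ (i, 0) = (B *\<^sub>v ?e) $ i" using that B by simp
      then show ?thesis unfolding Be using that by (simp add: unit_vec_def)
    qed
    have Bs: "B $$ (j, i) = B $$ (i, j)" if "i < Suc n" "j < Suc n" for i j
      using arg_cong[OF Bsym, of "\<lambda>M. M $$ (i, j)"] that B by simp
    define C where "C = mat n n (\<lambda>(i, j). B $$ (Suc i, Suc j))"
    have C: "C \<in> carrier_mat n n" by (simp add: C_def)
    have "transpose_mat C = C" by (rule eq_matI) (auto simp: C_def Bs)
    from Suc.IH[OF C this] obtain P d where P: "P \<in> carrier_mat n n"
      and PP: "transpose_mat P * P = 1\<^sub>m n" and CP: "C = P * mat_diag n d * transpose_mat P" by auto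
    \<comment> \<open>The eigenvalue \<open>e\<close> is put in front of those of \<open>C\<close>,
      and \<open>P\<close> is bordered by a 1 to match. The orthogonal matrix for \<open>A\<close>
      is then \<open>H * F\<close>.\<close>
    define d' where "d' i = (case i of 0 \<Rightarrow> e | Suc k \<Rightarrow> d k)" for i
    let ?O = "0\<^sub>m 1 n :: real mat" and ?O' = "0\<^sub>m n 1 :: real mat"
    define F where "F = four_block_mat (1\<^sub>m 1) ?O ?O' P"
    have F: "F \<in> carrier_mat (Suc n) (Suc n)" 
      using four_block_carrier_mat[of "1\<^sub>m 1 :: real mat" 1 1 P n n ?O ?O'] P by (simp add: F_def)
    have Ft: "transpose_mat F = four_block_mat (1\<^sub>m 1) ?O ?O' (transpose_mat P)"
      unfolding F_def using P by (subst transpose_four_block_mat[of _ 1 1 _ n _ n]) auto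
    have FF: "transpose_mat F * F = 1\<^sub>m (Suc n)"
      unfolding Ft unfolding F_def using P PP
      by (subst mult_four_block_mat[of _ 1 1 _ n _ n _ _ 1 _ n]) auto
    have D: "mat_diag (Suc n) d' = four_block_mat (e \<cdot>\<^sub>m 1\<^sub>m 1) ?O ?O' (mat_diag n d)"
      by (rule eq_matI) (auto simp: d'_def mat_diag_def split: nat.splits)
    have "B = four_block_mat (e \<cdot>\<^sub>m 1\<^sub>m 1) ?O ?O' C"
    proof (rule eq_matI)
      fix i j assume "i < dim_row (four_block_mat (e \<cdot>\<^sub>m 1\<^sub>m 1) ?O ?O' C)"
        "j < dim_col (four_block_mat (e \<cdot>\<^sub>m 1\<^sub>m 1) ?O ?O' C)"
      then have "i < Suc n" "j < Suc n" by (auto simp: C_def)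
      then show "B $$ (i, j) = four_block_mat (e \<cdot>\<^sub>m 1\<^sub>m 1) ?O ?O' C $$ (i, j)"
        using B0[of i] B0[of j] Bs[of 0 j] by (cases i; cases j) (auto simp: C_def)
    qed (use B in \<open>auto simp: C_def\<close>)
    also have "\<dots> = four_block_mat (e \<cdot>\<^sub>m 1\<^sub>m 1) ?O ?O' (P * mat_diag n d) * transpose_mat F"
    proof -
      define E where "E = P * mat_diag n d"
      have E: "E \<in> carrier_mat n n" using mult_carrier_mat[OF P mat_diag_dim] by (simp add: E_def)
      moreover from this have "E * transpose_mat P \<in> carrier_mat n n"
        using P by (meson mult_carrier_mat transpose_carrier_mat)
      ultimately show ?thesis
        unfolding Ft CP E_def[symmetric] using P
        by (subst mult_four_block_mat[of _ 1 1 _ n _ n _ _ 1 _ n]) auto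
    qed
    also have "four_block_mat (e \<cdot>\<^sub>m 1\<^sub>m 1) ?O ?O' (P * mat_diag n d) = F * mat_diag (Suc n) d'"
      unfolding D unfolding F_def using P mult_carrier_mat[OF P mat_diag_dim, of d]
      by (subst mult_four_block_mat[of _ 1 1 _ n _ n _ _ 1 _ n])
        (auto simp: left_mult_zero_mat[of _ n n])
    finally have BF: "B = F * mat_diag (Suc n) d' * transpose_mat F" .
    note assoc = assoc_mult_mat[of _ "Suc n" "Suc n" _ "Suc n" _ "Suc n"]
    have Dc: "mat_diag (Suc n) d' \<in> carrier_mat (Suc n) (Suc n)" by simp
    have HFt: "transpose_mat (H * F) = transpose_mat F * H"
      using transpose_mult[OF H F] Hsym by simp
    have "transpose_mat (H * F) * (H * F) = transpose_mat F * (H * H) * F"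
      unfolding HFt using H F by (simp add: assoc)
    then have 1: "transpose_mat (H * F) * (H * F) = 1\<^sub>m (Suc n)"
      using F FF by (simp add: HH)
    have 2: "A = (H * F) * mat_diag (Suc n) d' * transpose_mat (H * F)"
      unfolding AB BF HFt using H F Dc
      by (simp add: assoc mult_carrier_mat[of _ "Suc n" "Suc n" _ "Suc n"])
    show ?case
      by (intro exI[of _ "H * F"] exI[of _ d'] conjI 1 2) (use H F in simp)
  qed
  then obtain P d where P: "P \<in> carrier_mat n n" "transpose_mat P * P = 1\<^sub>m n"
    "A = P * mat_diag n d * transpose_mat P" by blast
  moreover have "P * transpose_mat P = 1\<^sub>m n"
    using mat_mult_left_right_inverse[of "transpose_mat P" n P] P by simp
  ultimately show thesis using that by blast
qed

subsection \<open>Matrices with one negative eigenvalue\<close>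

text \<open>Orders add up over products, and a monic linear factor has order 1 at its root and 0
  elsewhere. This converts algebraic multiplicities into a count of diagonal entries.\<close>

lemma order_prod_linear_factors:
  fixes d :: "'b \<Rightarrow> 'a :: field"
  assumes "finite S"
  shows "order x (\<Prod>i\<in>S. [:- d i, 1:]) = card {i\<in>S. d i = x}"
  using assms
proof (induction S rule: finite_induct)
  case (insert j S)
  have "order x (\<Prod>i\<in>insert j S. [:- d i, 1:]) = order x [:- d j, 1:] + card {i\<in>S. d i = x}"
    using insert by (simp add: order_mult del: mult_pCons_left)
  moreover have "order x [:- d j, 1:] = (if d j = x then 1 else 0)"
    using order_power_n_n[of x 1] by (auto intro: order_0I)
  moreover have "{i\<in>insert j S. d i = x} = (if d j = x then insert j else id) {i\<in>S. d i = x}"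
    by auto
  ultimately show ?case using insert by simp
qed auto

text \<open>\<open>A\<close> shares its characteristic polynomial with the diagonal matrix, where
  the entries of \<open>d\<close> are the roots with multiplicity.\<close>

lemma num_neg_eigenvalues_diagonalized:
  assumes P: "P \<in> carrier_mat n n" "transpose_mat P * P = 1\<^sub>m n" "P * transpose_mat P = 1\<^sub>m n"
    and A: "A = P * mat_diag n d * transpose_mat P"
  shows "num_neg_eigenvalues A = card {i. i < n \<and> d i < 0}"
proof -
  let ?D = "mat_diag n d"
  have Ac: "A \<in> carrier_mat n n"
    unfolding A using P(1) by (simp add: mult_carrier_mat[of _ n n _ n])
  have "similar_mat_wit A ?D P (transpose_mat P)"
    using P A Ac by (auto simp: similar_mat_wit_def Let_def)
  then have "char_poly A = char_poly ?D"
    by (intro char_poly_similar) (auto simp: similar_mat_def)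
  also have "\<dots> = (\<Prod>a\<leftarrow>diag_mat ?D. [:- a, 1:])"
    by (rule char_poly_upper_triangular[of _ n]) (auto simp: mat_diag_def)
  also have "diag_mat ?D = map d [0..<n]"
    by (auto simp: diag_mat_def mat_diag_def)
  also have "(\<Prod>a\<leftarrow>map d [0..<n]. [:- a, 1:]) = (\<Prod>i\<in>{..<n}. [:- d i, 1:])"
    by (simp add: comp_def prod.distinct_set_conv_list[symmetric] lessThan_atLeast0)
  finally have cp: "char_poly A = (\<Prod>i\<in>{..<n}. [:- d i, 1:])" .
  let ?N = "{i. i < n \<and> d i < 0}"
  have "{x. eigenvalue A x \<and> x < 0} = d ` ?N"
    unfolding eigenvalue_root_char_poly[OF Ac] cp by (auto simp: poly_prod)
  then have "num_neg_eigenvalues A = (\<Sum>x\<in>d ` ?N. card {i\<in>{..<n}. d i = x})"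
    unfolding num_neg_eigenvalues_def cp by (simp add: order_prod_linear_factors)
  \<comment> \<open>The fibres of \<open>d\<close> over its distinct negative values partition
    \<open>?N\<close>.\<close>
  also have "\<dots> = (\<Sum>x\<in>d ` ?N. \<Sum>i\<in>{i. i \<in> ?N \<and> d i = x}. 1)"
    by (rule sum.cong) (auto intro!: arg_cong[of _ _ card])
  also have "\<dots> = card ?N"
    by (subst sum.image_gen[symmetric]) auto
  finally show ?thesis .
qed

text \<open>With \<open>a\<close> and \<open>b\<close> the values of a functional at two vectors,
  this says that a plane meets every hyperplane nontrivially.\<close>

lemma nontrivial_kernel_of_functional:
  fixes a b :: real
  obtains s t where "s * a + t * b = 0" "s \<noteq> 0 \<or> t \<noteq> 0"
proof (cases "b = 0")
  case True
  then show thesis using that[of 0 1] by simp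
next
  case False
  then show thesis using that[of b "- a"] by simp
qed

text \<open>The right-hand side is the Courant--Fischer description of a single negative eigenvalue.\<close>

theorem num_neg_eigenvalues_eq_1_iff:
  assumes A: "A \<in> carrier_mat n n" "transpose_mat A = A"
  shows "num_neg_eigenvalues A = 1 \<longleftrightarrow>
    (\<exists>x\<in>carrier_vec n. x \<bullet> (A *\<^sub>v x) < 0) \<and>
    (\<exists>q\<in>carrier_vec n. \<forall>x\<in>carrier_vec n. q \<bullet> x = 0 \<longrightarrow> x \<bullet> (A *\<^sub>v x) \<ge> 0)"
proof -
  obtain P d where P: "P \<in> carrier_mat n n" "transpose_mat P * P = 1\<^sub>m n" "P * transpose_mat P = 1\<^sub>m n"
    and AP: "A = P * mat_diag n d * transpose_mat P"
    using symmetric_real_diagonalization[OF A] by metis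
  let ?c = "col P"
  define N where "N = {i. i < n \<and> d i < 0}"
  have N: "num_neg_eigenvalues A = card N"
    using num_neg_eigenvalues_diagonalized[OF P AP] by (simp add: N_def)
  have c: "?c i \<in> carrier_vec n" for i using P by auto
  have cc: "?c i \<bullet> ?c j = (if i = j then 1 else 0)" if "i < n" "j < n" for i j
    using arg_cong[OF P(2), of "\<lambda>M. M $$ (i, j)"] that P(1) by simp
  \<comment> \<open>The orthonormal columns of \<open>P\<close> are eigenvectors, so in the
    coordinates \<open>?c i \<bullet> x\<close> the form is a weighted sum of squares.\<close>
  have form: "x \<bullet> (A *\<^sub>v x) = (\<Sum>i<n. d i * (?c i \<bullet> x)\<^sup>2)" if x: "x \<in> carrier_vec n" for x
  proof -
    define y where "y = transpose_mat P *\<^sub>v x"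
    have y: "y \<in> carrier_vec n" using x P by (simp add: y_def)
    have Dy: "mat_diag n d *\<^sub>v y \<in> carrier_vec n" by (rule mult_mat_vec_carrier) (use y in simp_all)
    have "x \<bullet> (A *\<^sub>v x) = x \<bullet> (P *\<^sub>v (mat_diag n d *\<^sub>v y))"
      unfolding AP y_def using P(1) x
      by (simp add: assoc_mult_mat_vec[of _ n n _ n] mult_carrier_mat[of _ n n _ n])
    also have "\<dots> = y \<bullet> (mat_diag n d *\<^sub>v y)"
      using transpose_vec_mult_scalar[OF P(1) Dy x] by (simp add: y_def)
    also have "\<dots> = (\<Sum>i<n. d i * (y $ i)\<^sup>2)"
    proof -
      have "(mat_diag n d *\<^sub>v y) $ i = d i * y $ i" if "i < n" for i
      proof -
        have "(mat_diag n d *\<^sub>v y) $ i = (\<Sum>j\<in>{0..<n}. (if i = j then d j else 0) * y $ j)"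
          using that y by (simp add: mat_diag_def scalar_prod_def)
        also have "\<dots> = (\<Sum>j\<in>{0..<n}. if j = i then d i * y $ i else 0)"
          by (rule sum.cong) auto
        finally show ?thesis using that by simp
      qed
      then show ?thesis using y
        by (auto simp: scalar_prod_def power2_eq_square lessThan_atLeast0 mat_diag_def intro!: sum.cong)
    qed
    also have "\<dots> = (\<Sum>i<n. d i * (?c i \<bullet> x)\<^sup>2)"
      by (rule sum.cong) (use P x in \<open>auto simp: y_def\<close>)
    finally show ?thesis .
  qed
  show ?thesis
  proof
    assume "num_neg_eigenvalues A = 1"
    then obtain i where Ni: "N = {i}" using N by (metis card_1_singletonE)
    then have i: "i < n" "d i < 0" by (auto simp: N_def)
    \<comment> \<open>The only negative eigenvector serves twice: the form is negative at it, and
      nonnegative on its orthogonal complement.\<close>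
    have "?c i \<bullet> (A *\<^sub>v ?c i) = (\<Sum>j<n. if j = i then d i else 0)"
      unfolding form[OF c] by (rule sum.cong) (use i in \<open>auto simp: cc\<close>)
    then have 1: "?c i \<bullet> (A *\<^sub>v ?c i) < 0" using i by simp
    have 2: "x \<bullet> (A *\<^sub>v x) \<ge> 0" if x: "x \<in> carrier_vec n" and ix: "?c i \<bullet> x = 0" for x
      unfolding form[OF x]
    proof (rule sum_nonneg)
      fix j assume "j \<in> {..<n}"
      moreover have "j = i \<or> j \<notin> N" using Ni by auto
      ultimately show "d j * (?c j \<bullet> x)\<^sup>2 \<ge> 0" using ix by (auto simp: N_def)
    qed
    show "(\<exists>x\<in>carrier_vec n. x \<bullet> (A *\<^sub>v x) < 0) \<and>
      (\<exists>q\<in>carrier_vec n. \<forall>x\<in>carrier_vec n. q \<bullet> x = 0 \<longrightarrow> x \<bullet> (A *\<^sub>v x) \<ge> 0)"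
      using 1 2 c by blast
  next
    assume r: "(\<exists>x\<in>carrier_vec n. x \<bullet> (A *\<^sub>v x) < 0) \<and>
      (\<exists>q\<in>carrier_vec n. \<forall>x\<in>carrier_vec n. q \<bullet> x = 0 \<longrightarrow> x \<bullet> (A *\<^sub>v x) \<ge> 0)"
    then obtain x0 q where x0: "x0 \<in> carrier_vec n" "x0 \<bullet> (A *\<^sub>v x0) < 0"
      and q: "q \<in> carrier_vec n" 
      and qx: "\<And>x. x \<in> carrier_vec n \<Longrightarrow> q \<bullet> x = 0 \<Longrightarrow> x \<bullet> (A *\<^sub>v x) \<ge> 0" by blast
    have "\<exists>i\<in>{..<n}. d i * (?c i \<bullet> x0)\<^sup>2 < 0"
      using x0(2) unfolding form[OF x0(1)] by (meson not_le sum_nonneg)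
    then obtain i where i: "i < n" "d i < 0" by (auto simp: mult_less_0_iff)
    \<comment> \<open>A second negative index would make the form negative definite on the plane
      spanned by \<open>?c i\<close> and \<open>?c j\<close>, which contains a nonzero vector
      orthogonal to \<open>q\<close>.\<close>
    have "j = i" if "j \<in> N" for j
    proof (rule ccontr)
      assume ji: "j \<noteq> i"
      from that have j: "j < n" "d j < 0" by (auto simp: N_def)
      obtain s t where st: "s * (q \<bullet> ?c i) + t * (q \<bullet> ?c j) = 0" "s \<noteq> 0 \<or> t \<noteq> 0"
        using nontrivial_kernel_of_functional .
      define x where "x = s \<cdot>\<^sub>v ?c i + t \<cdot>\<^sub>v ?c j"
      have x: "x \<in> carrier_vec n" using c by (simp add: x_def)
      have qx0: "q \<bullet> x = 0" 
        unfolding x_def using c q st(1) by (subst scalar_prod_add_distrib[of _ n]) auto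
      have cx: "?c k \<bullet> x = (if k = i then s else if k = j then t else 0)" if "k < n" for k
      proof -
        have "?c k \<bullet> x = s * (?c k \<bullet> ?c i) + t * (?c k \<bullet> ?c j)"
          unfolding x_def using c by (subst scalar_prod_add_distrib[of _ n]) auto
        then show ?thesis using that i j ji by (auto simp: cc)
      qed
      have "x \<bullet> (A *\<^sub>v x) = (\<Sum>k<n. (if k = i then d i * s\<^sup>2 else 0) + (if k = j then d j * t\<^sup>2 else 0))"
        unfolding form[OF x] by (rule sum.cong) (use ji in \<open>auto simp: cx\<close>)
      also have "\<dots> = d i * s\<^sup>2 + d j * t\<^sup>2" using i j by (simp add: sum.distrib)
      also have "\<dots> < 0"
      proof (cases "s = 0")
        case True
        then show ?thesis using st(2) j by (simp add: mult_neg_pos)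
      next
        case False
        then have "d i * s\<^sup>2 < 0" using i by (simp add: mult_neg_pos)
        moreover have "d j * t\<^sup>2 \<le> 0" using j by (simp add: mult_nonpos_nonneg)
        ultimately show ?thesis by simp
      qed
      finally show False using qx[OF x qx0] by simp
    qed
    then have "N \<subseteq> {i}" by blast
    moreover have "i \<in> N" using i by (simp add: N_def)
    ultimately have "N = {i}" by blast
    then show "num_neg_eigenvalues A = 1" using N by simp
  qed
qed

section \<open>The quadratic form of a weighted graph\<close>

definition edge_weight :: "'a pair_pre_digraph \<Rightarrow> ('a set \<Rightarrow> real) \<Rightarrow> 'a \<Rightarrow> 'a \<Rightarrow> real" where
  "edge_weight G w x y = (if (x, y) \<in> parcs G then w {x, y} else 0)"

text \<open>Indexing by vertices instead of list positions makes the form independent of an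
  ordering. Every edge enters twice, once for each direction.\<close>

definition adjacency_form :: "'a pair_pre_digraph \<Rightarrow> ('a set \<Rightarrow> real) \<Rightarrow> ('a \<Rightarrow> real) \<Rightarrow> real" where
  "adjacency_form G w x = (\<Sum>a\<in>pverts G. \<Sum>b\<in>pverts G. edge_weight G w a b * x a * x b)"

lemma edge_weight_commute:
  assumes "pair_graph G"
  shows "edge_weight G w x y = edge_weight G w y x"
proof -
  interpret pair_graph G by fact
  have "(x, y) \<in> parcs G \<longleftrightarrow> (y, x) \<in> parcs G" using pair_sym_arcs by (auto simp: symmetric_def sym_def)
  then show ?thesis by (simp add: edge_weight_def insert_commute)
qed

theorem neg_index_eq_1_iff:
  assumes G: "pair_graph G"
  shows "neg_index G w = 1 \<longleftrightarrow>
    (\<exists>x. adjacency_form G w x < 0) \<and>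
    (\<exists>q. \<forall>x. (\<Sum>a\<in>pverts G. q a * x a) = 0 \<longrightarrow> adjacency_form G w x \<ge> 0)"
proof -
  interpret pair_graph G by fact
  obtain vs where vs: "set vs = pverts G" "distinct vs"
    using finite_distinct_list[OF pair_finite_verts] by blast
  define n where "n = length vs"
  define A where "A = adjacency_matrix G w vs"
  have A: "A \<in> carrier_mat n n" by (simp add: A_def adjacency_matrix_def n_def)
  have Aij: "A $$ (i, j) = edge_weight G w (vs ! i) (vs ! j)" if "i < n" "j < n" for i j
    using that by (simp add: A_def adjacency_matrix_def n_def edge_weight_def)
  have Asym: "transpose_mat A = A"
    by (rule eq_matI) (use A in \<open>auto simp: Aij edge_weight_commute[OF G]\<close>)
  have bij: "bij_betw ((!) vs) {0..<n} (pverts G)"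
    using bij_betw_nth[OF vs(2) refl] vs(1) by (simp add: n_def lessThan_atLeast0)
  \<comment> \<open>A listing of the vertices identifies functions on them with coordinate vectors.
    \<open>V\<close> is onto, so quantifiers over vectors become quantifiers over functions.\<close>
  define V where "V x = vec n (\<lambda>i. x (vs ! i))" for x :: "'a \<Rightarrow> real"
  have V: "V x \<in> carrier_vec n" for x by (simp add: V_def)
  have range_V: "carrier_vec n = range V"
  proof (intro equalityI subsetI)
    fix X :: "real vec" assume "X \<in> carrier_vec n"
    then have "X = V (\<lambda>a. X $ inv_into {0..<n} ((!) vs) a)"
      using bij by (intro eq_vecI) (auto simp: V_def bij_betw_def inv_into_f_f)
    then show "X \<in> range V" by blast
  qed (use V in auto)
  have VV: "V q \<bullet> V x = (\<Sum>a\<in>pverts G. q a * x a)" for q x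
    by (subst sum.reindex_bij_betw[OF bij, symmetric]) (simp add: V_def scalar_prod_def)
  have VA: "V x \<bullet> (A *\<^sub>v V x) = adjacency_form G w x" for x
  proof -
    have "V x \<bullet> (A *\<^sub>v V x) =
      (\<Sum>i\<in>{0..<n}. \<Sum>j\<in>{0..<n}. edge_weight G w (vs ! i) (vs ! j) * x (vs ! i) * x (vs ! j))"
      using A by (simp add: V_def scalar_prod_def sum_distrib_left Aij mult_ac)
    then show ?thesis
      unfolding adjacency_form_def
      by (simp add: sum.reindex_bij_betw[OF bij, symmetric])
  qed
  show ?thesis
    unfolding neg_index_eq[OF vs(2,1)] A_def[symmetric] num_neg_eigenvalues_eq_1_iff[OF A Asym]
      range_V by (simp add: VV VA)
qed

subsection \<open>Graphs with one negative eigenvalue\<close>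

lemma sum_square_supported:
  fixes f :: "'a \<Rightarrow> 'a \<Rightarrow> 'b :: comm_monoid_add"
  assumes "finite V" "S \<subseteq> V" "\<And>a b. a \<notin> S \<or> b \<notin> S \<Longrightarrow> f a b = 0"
  shows "(\<Sum>a\<in>V. \<Sum>b\<in>V. f a b) = (\<Sum>a\<in>S. \<Sum>b\<in>S. f a b)"
proof -
  have "(\<Sum>a\<in>V. \<Sum>b\<in>V. f a b) = (\<Sum>a\<in>V. \<Sum>b\<in>S. f a b)"
    by (rule sum.cong[OF refl], rule sum.mono_neutral_right) (use assms in auto)
  also have "\<dots> = (\<Sum>a\<in>S. \<Sum>b\<in>S. f a b)"
    by (rule sum.mono_neutral_right) (use assms in auto)
  finally show ?thesis .
qed

text \<open>Completing the square. Up to a negative factor this is the adjacency form on the test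
  plane of a triangle.\<close>

lemma sum_squares_add_mult_pos:
  fixes s t :: real
  assumes "s \<noteq> 0 \<or> t \<noteq> 0"
  shows "s\<^sup>2 + s * t + t\<^sup>2 > 0"
proof -
  have "s\<^sup>2 + s * t + t\<^sup>2 = (s + t / 2)\<^sup>2 + 3 / 4 * t\<^sup>2" by (simp add: power2_eq_square field_simps)
  moreover have "(s + t / 2)\<^sup>2 + 3 / 4 * t\<^sup>2 > 0"
    using assms by (cases "t = 0") (auto intro: add_nonneg_pos)
  ultimately show ?thesis by simp
qed

locale weighted_pair_graph = pair_graph G for G :: "'a pair_pre_digraph" +
  fixes w :: "'a set \<Rightarrow> real"
  assumes weight_pos: "e \<in> edges G \<Longrightarrow> w e > 0"
begin

abbreviation W :: "'a \<Rightarrow> 'a \<Rightarrow> real" where "W \<equiv> edge_weight G w"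

lemma pair_graph: "pair_graph G" by unfold_locales

lemma arcs_sym: "(x, y) \<in> parcs G \<longleftrightarrow> (y, x) \<in> parcs G"
  using pair_sym_arcs by (auto simp: symmetric_def sym_def)

lemma W_pos: "(x, y) \<in> parcs G \<Longrightarrow> W x y > 0"
  using weight_pos[of "{x, y}"] by (auto simp: edge_weight_def edges_def)

lemma W_pos_iff: "W x y > 0 \<longleftrightarrow> (x, y) \<in> parcs G"
  using W_pos by (auto simp: edge_weight_def)

lemma W_eq_0_iff: "W x y = 0 \<longleftrightarrow> (x, y) \<notin> parcs G"
  using W_pos[of x y] by (auto simp: edge_weight_def)

lemma W_commute: "W x y = W y x"
  using edge_weight_commute[OF pair_graph] .

lemma W_refl [simp]: "W x x = 0"
  using no_loops'[of x x] by (auto simp: W_eq_0_iff)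

lemma adjacency_form_supported:
  assumes "S \<subseteq> pverts G" "\<And>a. a \<notin> S \<Longrightarrow> x a = 0"
  shows "adjacency_form G w x = (\<Sum>a\<in>S. \<Sum>b\<in>S. W a b * x a * x b)"
  unfolding adjacency_form_def
  by (rule sum_square_supported) (use assms pair_finite_verts in auto)

end

locale neg_index_1_graph = weighted_pair_graph +
  assumes neg_index_1: "neg_index G w = 1"
begin

text \<open>The span of \<open>f\<close> and \<open>g\<close> meets the hyperplane on which the form
  is nonnegative. Forbidden configurations are excluded by choosing \<open>f\<close> and
  \<open>g\<close> so that the form is negative at all such combinations.\<close>

lemma form_nonneg_in_plane:
  obtains s t where "s \<noteq> 0 \<or> t \<noteq> 0" "adjacency_form G w (\<lambda>a. s * f a + t * g a) \<ge> 0"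
proof -
  obtain q where q: "\<And>x. (\<Sum>a\<in>pverts G. q a * x a) = 0 \<Longrightarrow> adjacency_form G w x \<ge> 0"
    using neg_index_1 unfolding neg_index_eq_1_iff[OF pair_graph] by blast
  obtain s t where st: "s * (\<Sum>a\<in>pverts G. q a * f a) + t * (\<Sum>a\<in>pverts G. q a * g a) = 0"
    "s \<noteq> 0 \<or> t \<noteq> 0"
    using nontrivial_kernel_of_functional .
  have "(\<Sum>a\<in>pverts G. q a * (s * f a + t * g a)) =
    s * (\<Sum>a\<in>pverts G. q a * f a) + t * (\<Sum>a\<in>pverts G. q a * g a)"
    by (simp add: sum_distrib_left sum.distrib algebra_simps)
  then have "(\<Sum>a\<in>pverts G. q a * (s * f a + t * g a)) = 0" using st(1) by simp
  from q[OF this] st(2) show thesis using that by blast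
qed

lemma triangle_free:
  assumes "(p, q) \<in> parcs G" "(q, r) \<in> parcs G"
  shows "(p, r) \<notin> parcs G"
proof
  assume "(p, r) \<in> parcs G"
  note arcs = assms this
  define a where "a = W p q"
  define b where "b = W p r"
  define c where "c = W q r"
  have pos: "a > 0" "b > 0" "c > 0" using arcs by (auto simp: a_def b_def c_def W_pos)
  have sym: "W q p = a" "W r p = b" "W r q = c" by (simp_all add: a_def b_def c_def W_commute)
  have ne: "p \<noteq> q" "p \<noteq> r" "q \<noteq> r" using arcs no_loops' by auto
  have V: "{p, q, r} \<subseteq> pverts G" using arcs in_arcsD1 in_arcsD2 by auto
  \<comment> \<open>Rescaling the coordinates at \<open>p\<close>, \<open>q\<close>,
    \<open>r\<close> by \<open>c\<close>, \<open>b\<close>, \<open>a\<close> makes all three edge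
    terms of the form equal in weight. \<open>f\<close> and \<open>g\<close> span the plane where
    the rescaled coordinates sum to 0; there the sum of their pairwise products is minus half the
    sum of their squares.\<close>
  define f where "f v = (if v = p then c else if v = r then - a else 0)" for v
  define g where "g v = (if v = q then b else if v = r then - a else 0)" for v
  obtain s t where st: "s \<noteq> 0 \<or> t \<noteq> 0" and ge: "adjacency_form G w (\<lambda>v. s * f v + t * g v) \<ge> 0"
    using form_nonneg_in_plane .
  have "adjacency_form G w (\<lambda>v. s * f v + t * g v) = - (2 * a * b * c * (s\<^sup>2 + s * t + t\<^sup>2))"
    using ne by (subst adjacency_form_supported[OF V])
      (auto simp: f_def g_def sym a_def[symmetric] b_def[symmetric] c_def[symmetric]
        power2_eq_square algebra_simps)
  moreover have "2 * a * b * c * (s\<^sup>2 + s * t + t\<^sup>2) > 0"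
    using pos sum_squares_add_mult_pos[OF st] by simp
  ultimately show False using ge by simp
qed

text \<open>
  The matrix of the form on \<open>p, q, r, s\<close> has the off-diagonal block \<open>M = (W p r, W p s; W q r, W q s)\<close>,
  and the form is \<open>- 2 \<bar>M\<^sup>T x\<bar>\<^sup>2\<close> at \<open>(x, - M\<^sup>T x)\<close>; hence \<open>M\<close> is singular.
\<close>

lemma rank_one_block:
  assumes V: "p \<in> pverts G" "q \<in> pverts G" "r \<in> pverts G" "s \<in> pverts G"
    and ne: "distinct [p, q, r, s]"
    and nadj: "(p, q) \<notin> parcs G" "(r, s) \<notin> parcs G"
  shows "W p r * W q s = W p s * W q r"
proof (rule ccontr)
  assume det: "W p r * W q s \<noteq> W p s * W q r"
  define a b c d where "a = W p r" and "b = W p s" and "c = W q r" and "d = W q s"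
  note abcd = a_def b_def c_def d_def
  have sym: "W r p = a" "W s p = b" "W r q = c" "W s q = d" by (simp_all add: abcd W_commute)
  have zero: "W p q = 0" "W q p = 0" "W r s = 0" "W s r = 0"
    using nadj by (simp_all add: W_eq_0_iff arcs_sym[of q] arcs_sym[of s])
  define f where "f v = (if v = p then 1 else if v = r then - a else if v = s then - b else 0)" for v
  define g where "g v = (if v = q then 1 else if v = r then - c else if v = s then - d else 0)" for v
  obtain h k where hk: "h \<noteq> 0 \<or> k \<noteq> 0" and ge: "adjacency_form G w (\<lambda>v. h * f v + k * g v) \<ge> 0"
    using form_nonneg_in_plane .
  define x where "x v = h * f v + k * g v" for v
  have x: "x p = h" "x q = k" "x r = - (h * a + k * c)" "x s = - (h * b + k * d)"
    using ne by (auto simp: x_def f_def g_def)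
  have "adjacency_form G w x = (\<Sum>i\<in>{p, q, r, s}. \<Sum>j\<in>{p, q, r, s}. W i j * x i * x j)"
    by (rule adjacency_form_supported) (use V in \<open>auto simp: x_def f_def g_def\<close>)
  also have "\<dots> = 2 * (a * x p * x r + b * x p * x s + c * x q * x r + d * x q * x s)"
    using ne by (simp add: sym zero abcd[symmetric])
  also have "\<dots> = - (2 * ((h * a + k * c)\<^sup>2 + (h * b + k * d)\<^sup>2))"
    unfolding x by (simp add: power2_eq_square algebra_simps)
  finally have "adjacency_form G w x = - (2 * ((h * a + k * c)\<^sup>2 + (h * b + k * d)\<^sup>2))" .
  then have "(h * a + k * c)\<^sup>2 + (h * b + k * d)\<^sup>2 \<le> 0"
    using ge by (simp add: x_def[abs_def])
  then have "(h * a + k * c)\<^sup>2 = 0 \<and> (h * b + k * d)\<^sup>2 = 0"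
    by (smt (verit) zero_le_power2)
  then have "h * a + k * c = 0" "h * b + k * d = 0" by simp_all
  \<comment> \<open>Cramer's rule: \<open>(h, k)\<close> lies in the kernel of the transposed block,
    so the determinant times \<open>h\<close> and times \<open>k\<close> vanishes.\<close>
  moreover have "h * (a * d - b * c) = d * (h * a + k * c) - c * (h * b + k * d)"
    "k * (a * d - b * c) = a * (h * b + k * d) - b * (h * a + k * c)"
    by (simp_all add: algebra_simps)
  ultimately have "h * (a * d - b * c) = 0" "k * (a * d - b * c) = 0" by simp_all
  then show False using hk det by (auto simp: abcd)
qed

end

section \<open>Edge counts and connectivity\<close>

lemma card_complete_bipartite_edges:
  assumes "parcs G = A \<times> B \<union> B \<times> A" "A \<inter> B = {}"
  shows "card (edges G) = card A * card B"
proof -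
  have "edges G = (\<lambda>(a, b). {a, b}) ` (A \<times> B)"
    unfolding edges_def assms(1) by (auto simp: insert_commute)
  moreover have "inj_on (\<lambda>(a, b). {a, b}) (A \<times> B)"
    using assms(2) by (auto simp: inj_on_def doubleton_eq_iff)
  ultimately show ?thesis by (simp add: card_image card_cartesian_product)
qed

text \<open>The equation is \<open>(m - 1) * (n - 1) = 2\<close> in disguise, and 2 factors only as
  1 times 2.\<close>

lemma mult_eq_add_1_cases:
  fixes m n :: nat
  assumes "m * n = m + n + 1"
  shows "m = 2 \<and> n = 3 \<or> m = 3 \<and> n = 2"
proof -
  have "m \<noteq> 0" "n \<noteq> 0" using assms by (auto intro!: Nat.gr0I)
  then obtain i j where ij: "m = Suc i" "n = Suc j" by (metis not0_implies_Suc)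
  with assms have "i * j = 2" by simp
  then have "i dvd 2" by (metis dvd_triv_left)
  then have "i \<le> 2" by (rule dvd_imp_le) simp
  with \<open>i * j = 2\<close> ij show ?thesis by (auto simp: le_Suc_eq numeral_2_eq_2)
qed

text \<open>Since the arcs are symmetric, connectedness means directed reachability in
  \<open>G\<close> itself, and a set closed under arcs is closed under reachability.\<close>

lemma (in pair_graph) connected_closed_set:
  assumes "connected (with_proj G)"
    and "S \<noteq> {}" "S \<subseteq> pverts G"
    and closed: "\<And>x y. x \<in> S \<Longrightarrow> (x, y) \<in> parcs G \<Longrightarrow> y \<in> S"
  shows "S = pverts G"
proof -
  obtain x where x: "x \<in> S" using assms by auto
  have "y \<in> S" if "y \<in> pverts G" for y
  proof -
    have "x \<rightarrow>\<^sup>*\<^bsub>with_proj (mk_symmetric G)\<^esub> y"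
      using assms x that unfolding connected_def strongly_connected_def by auto
    then have "x \<rightarrow>\<^sup>*\<^bsub>with_proj G\<^esub> y"
      using reachable_mk_symmetric_eq[OF pair_sym_arcs] by simp
    then show "y \<in> S"
      by (induction rule: reachable_induct) (use x closed in auto)
  qed
  then show ?thesis using assms by auto
qed

section \<open>Classification of the graphs: complete bipartite, then theta\<close>

context neg_index_1_graph
begin

lemma complete_bipartite:
  assumes conn: "connected (with_proj G)" and ne: "parcs G \<noteq> {}"
  obtains A B where "A \<inter> B = {}" "A \<union> B = pverts G" "parcs G = A \<times> B \<union> B \<times> A"
proof -
  obtain u v where uv: "(u, v) \<in> parcs G" using ne by auto
  define A where "A = {x. (x, v) \<in> parcs G}"
  define B where "B = {x. (x, u) \<in> parcs G}"
  have uA: "u \<in> A" and vB: "v \<in> B" using uv arcs_sym by (auto simp: A_def B_def)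
  have AV: "A \<subseteq> pverts G" and BV: "B \<subseteq> pverts G" using in_arcsD1 by (auto simp: A_def B_def)
  have indepA: "(x, y) \<notin> parcs G" if "x \<in> A" "y \<in> A" for x y
    using that triangle_free[of x v y] arcs_sym by (auto simp: A_def)
  have indepB: "(x, y) \<notin> parcs G" if "x \<in> B" "y \<in> B" for x y
    using that triangle_free[of x u y] arcs_sym by (auto simp: B_def)
  have disj: "A \<inter> B = {}" using uA indepA unfolding B_def by auto
  have AB: "(a, b) \<in> parcs G" if a: "a \<in> A" and b: "b \<in> B" for a b
  \<comment> \<open>If \<open>a = u\<close> or \<open>b = v\<close>, the arc is given by the
    definition of \<open>B\<close> or \<open>A\<close>. Otherwise the block with rows
    \<open>a\<close>, \<open>u\<close> and columns \<open>v\<close>, \<open>b\<close> is singular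
    with a positive product \<open>W a v * W u b\<close>, which forces \<open>W a b\<close> to be
    nonzero.\<close>
  proof (cases "a = u \<or> b = v")
    case True
    then show ?thesis using a b arcs_sym by (auto simp: A_def B_def)
  next
    case False
    have "W a v * W u b = W a b * W u v"
    proof (rule rank_one_block)
      show "distinct [a, u, v, b]" using False a b uA vB disj by auto
    qed (use a b uA vB AV BV indepA indepB in auto)
    moreover have "W a v > 0" "W u b > 0" using a b arcs_sym by (auto simp: A_def B_def W_pos_iff)
    ultimately have "W a b \<noteq> 0" by (metis mult_pos_pos mult_zero_left less_irrefl)
    then show ?thesis by (simp add: W_eq_0_iff)
  qed
  have closedA: "z \<in> B" if y: "y \<in> A" and yz: "(y, z) \<in> parcs G" for y z
  proof (rule ccontr)
    assume zB: "z \<notin> B"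
    then have zu: "(z, u) \<notin> parcs G" by (simp add: B_def)
    have "y \<noteq> u" using zu yz arcs_sym by auto
    have zA: "z \<notin> A" using indepA y yz by auto
    \<comment> \<open>In the block with rows \<open>u\<close>, \<open>y\<close> and columns
      \<open>v\<close>, \<open>z\<close> the left product is positive, while the right one vanishes
      because \<open>z\<close> is not adjacent to \<open>u\<close>.\<close>
    have "W u v * W y z = W u z * W y v"
    proof (rule rank_one_block)
      show "distinct [u, y, v, z]" using \<open>y \<noteq> u\<close> zA zB uA vB y disj by auto
      show "(v, z) \<notin> parcs G" using zA arcs_sym by (auto simp: A_def)
    qed (use uA vB y AV BV indepA in_arcsD2[OF yz] in auto)
    moreover have "W u z = 0" using zu arcs_sym by (auto simp: W_eq_0_iff)
    ultimately show False using uv yz by (auto simp: W_eq_0_iff)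
  qed
  \<comment> \<open>The same argument with \<open>u\<close> and \<open>v\<close>, hence
    \<open>A\<close> and \<open>B\<close>, exchanged.\<close>
  have closedB: "z \<in> A" if y: "y \<in> B" and yz: "(y, z) \<in> parcs G" for y z
  proof (rule ccontr)
    assume zA: "z \<notin> A"
    then have zv: "(z, v) \<notin> parcs G" by (simp add: A_def)
    have "y \<noteq> v" using zv yz arcs_sym by auto
    have zB: "z \<notin> B" using indepB y yz by auto
    have "W v u * W y z = W v z * W y u"
    proof (rule rank_one_block)
      show "distinct [v, y, u, z]" using \<open>y \<noteq> v\<close> zA zB uA vB y disj by auto
      show "(u, z) \<notin> parcs G" using zB arcs_sym by (auto simp: B_def)
    qed (use uA vB y AV BV indepB in_arcsD2[OF yz] in auto)
    moreover have "W v z = 0" using zv arcs_sym by (auto simp: W_eq_0_iff)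
    ultimately show False using uv arcs_sym yz by (auto simp: W_eq_0_iff)
  qed
  have "A \<union> B = pverts G"
    by (rule connected_closed_set[OF conn]) (use uA AV BV closedA closedB in auto)
  moreover have "parcs G = A \<times> B \<union> B \<times> A"
  proof (intro equalityI subsetI)
    fix e assume "e \<in> parcs G"
    moreover obtain x y where "e = (x, y)" by (cases e)
    ultimately show "e \<in> A \<times> B \<union> B \<times> A"
      using in_arcsD1[of x y] closedA[of x y] closedB[of x y] \<open>A \<union> B = pverts G\<close> by auto
  qed (use AB arcs_sym in auto)
  ultimately show thesis using that disj by blast
qed

lemma complete_bipartite_2_3:
  assumes "connected (with_proj G)" "card (edges G) = card (pverts G) + 1"
  obtains A B where "card A = 2" "card B = 3" "A \<inter> B = {}" "A \<union> B = pverts G"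
    "parcs G = A \<times> B \<union> B \<times> A"
proof -
  \<comment> \<open>Without arcs the edge count would be 0, which is not a successor.\<close>
  have "parcs G \<noteq> {}" using assms(2) by (auto simp: edges_def)
  from complete_bipartite[OF assms(1) this] obtain A B
    where AB: "A \<inter> B = {}" "A \<union> B = pverts G" "parcs G = A \<times> B \<union> B \<times> A" .
  have "finite A" "finite B" using AB(2) pair_finite_verts by (auto intro: finite_subset)
  then have "card A * card B = card A + card B + 1"
    using card_complete_bipartite_edges[OF AB(3,1)] assms(2) AB(1)
    by (simp add: AB(2)[symmetric] card_Un_disjoint)
  then consider "card A = 2" "card B = 3" | "card B = 2" "card A = 3"
    using mult_eq_add_1_cases by blast
  then show thesis
    by cases (use that[of A B] that[of B A] AB in auto)
qed

lemma weighted_iso_theta111: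
  assumes "connected (with_proj G)" "card (edges G) = card (pverts G) + 1"
  shows "\<exists>a1 a2 b1 b2 c1 c2 :: real.
       a1 > 0 \<and> a2 > 0 \<and> b1 > 0 \<and> b2 > 0 \<and> c1 > 0 \<and> c2 > 0 \<and>
       c1 * a2 = a1 * c2 \<and> a2 * b1 = a1 * b2 \<and>
       weighted_iso G w theta111 (theta111_weight a1 a2 b1 b2 c1 c2)"
proof -
  obtain A B where AB: "card A = 2" "card B = 3" "A \<inter> B = {}" "A \<union> B = pverts G"
    and arcs: "parcs G = A \<times> B \<union> B \<times> A"
    using complete_bipartite_2_3[OF assms] .
  obtain u v where A: "A = {u, v}" "u \<noteq> v" using AB(1) by (meson card_2_iff)
  obtain x y z where B: "B = {x, y, z}" "x \<noteq> y" "x \<noteq> z" "y \<noteq> z" using AB(2) by (metis card_3_iff)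
  have ne: "u \<noteq> x" "u \<noteq> y" "u \<noteq> z" "v \<noteq> x" "v \<noteq> y" "v \<noteq> z" using AB(3) A B by auto
  note distinct = A(2) A(2)[symmetric] B(2-4) B(2-4)[symmetric] ne ne[symmetric]
  have V: "pverts G = {u, v, x, y, z}" using AB(4) A B by auto
  \<comment> \<open>The class of size 2 goes to the two branch vertices and the class of size 3 to
    the midpoints; any labelling within the classes will do.\<close>
  define f where "f p = (if p = u then Vu else if p = v then Vv else if p = x then Vx1
    else if p = y then Vy1 else Vz1)" for p
  have f: "f u = Vu" "f v = Vv" "f x = Vx1" "f y = Vy1" "f z = Vz1"
    using distinct by (auto simp: f_def)
  have iso: "weighted_iso G w theta111
    (theta111_weight (W u x) (W x v) (W u y) (W y v) (W u z) (W z v))" (is "weighted_iso _ _ _ ?w")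
    unfolding weighted_iso_def
  proof (intro exI[of _ f] conjI)
    show "bij_betw f (pverts G) (pverts theta111)"
      unfolding V by (rule bij_betw_imageI) (auto simp: inj_on_def f theta111_def)
    show "\<forall>p\<in>pverts G. \<forall>q\<in>pverts G. (p, q) \<in> parcs G \<longleftrightarrow> (f p, f q) \<in> parcs theta111"
      unfolding V arcs A(1) B(1) using distinct by (auto simp: f theta111_def)
    show "\<forall>p q. (p, q) \<in> parcs G \<longrightarrow> w {p, q} = ?w {f p, f q}"
    proof (intro allI impI)
      fix p q assume pq: "(p, q) \<in> parcs G"
      have AB_case: "W i j = ?w {f i, f j}" if "i \<in> A" "j \<in> B" for i j
      proof -
        from that consider "i = u" "j = x" | "i = u" "j = y" | "i = u" "j = z"
          | "i = v" "j = x" | "i = v" "j = y" | "i = v" "j = z"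
          unfolding A(1) B(1) by blast
        then show ?thesis
          by cases (simp_all add: f theta111_weight_def doubleton_eq_iff W_commute[of v])
      qed
      have "w {p, q} = W p q" using pq by (simp add: edge_weight_def)
      also have "\<dots> = ?w {f p, f q}"
        using pq AB_case[of p q] AB_case[of q p]
        unfolding arcs by (auto simp: W_commute[of p] insert_commute[of "f p"])
      finally show "w {p, q} = ?w {f p, f q}" .
    qed
  qed
  have pos: "W u x > 0" "W x v > 0" "W u y > 0" "W y v > 0" "W u z > 0" "W z v > 0"
    unfolding W_pos_iff arcs A B by auto
  \<comment> \<open>Each pair in \<open>B\<close> forms with \<open>u\<close> and \<open>v\<close> a
    singular block. The pairs \<open>z\<close>, \<open>x\<close> and \<open>y\<close>,
    \<open>x\<close> give the two equations for the weights.\<close>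
  have block: "W u i * W v j = W u j * W v i" if "i \<in> B" "j \<in> B" "i \<noteq> j" for i j
    by (rule rank_one_block) (use that A B AB arcs distinct in auto)
  have "W u z * W x v = W u x * W z v" "W x v * W u y = W u x * W y v"
    using block[of z x] block[of y x] B by (auto simp: W_commute[of v] mult.commute)
  with iso pos show ?thesis by blast
qed

end

section \<open>The converse: proportional weights on the theta graph\<close>

text \<open>The equations make the weights at \<open>Vv\<close> equal to \<open>a2 / a1\<close>
  times those at \<open>Vu\<close>, so the form factors and vanishes on the hyperplane
  \<open>a1 * t Vu + a2 * t Vv = 0\<close>.\<close>

lemma (in weighted_pair_graph) neg_index_eq_1_if_iso_theta111:
  assumes pos: "a1 > 0" and rank1: "c1 * a2 = a1 * c2" "a2 * b1 = a1 * b2"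
    and iso: "weighted_iso G w theta111 (theta111_weight a1 a2 b1 b2 c1 c2)"
  shows "neg_index G w = 1"
proof -
  let ?w = "theta111_weight a1 a2 b1 b2 c1 c2"
  obtain f where f: "bij_betw f (pverts G) (pverts theta111)"
    and farcs: "\<And>p q. p \<in> pverts G \<Longrightarrow> q \<in> pverts G \<Longrightarrow>
      (p, q) \<in> parcs G \<longleftrightarrow> (f p, f q) \<in> parcs theta111"
    and fw: "\<And>p q. (p, q) \<in> parcs G \<Longrightarrow> w {p, q} = ?w {f p, f q}"
    using iso unfolding weighted_iso_def by blast
  have verts: "pverts theta111 = {Vu, Vv, Vx1, Vy1, Vz1}" by (simp add: theta111_def)
  have W: "W p q = edge_weight theta111 ?w (f p) (f q)" if "p \<in> pverts G" "q \<in> pverts G" for p q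
    using farcs[OF that] fw[of p q] by (simp add: edge_weight_def)
  have form: "adjacency_form G w (t \<circ> f) =
    2 * (t Vu * (a1 * t Vx1 + b1 * t Vy1 + c1 * t Vz1) + t Vv * (a2 * t Vx1 + b2 * t Vy1 + c2 * t Vz1))" for t
  proof -
    have "adjacency_form G w (t \<circ> f) = (\<Sum>p\<in>pverts G. \<Sum>q\<in>pverts G.
      edge_weight theta111 ?w (f p) (f q) * t (f p) * t (f q))"
      unfolding adjacency_form_def by (simp add: W cong: sum.cong)
    also have "\<dots> = (\<Sum>p\<in>pverts theta111. \<Sum>q\<in>pverts theta111. edge_weight theta111 ?w p q * t p * t q)"
      by (simp add: sum.reindex_bij_betw[OF f, symmetric])
    finally show ?thesis
      by (simp add: verts edge_weight_def theta111_weight_def theta111_def doubleton_eq_iff algebra_simps)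
  qed
  \<comment> \<open>On the single edge between \<open>Vu\<close> and \<open>Vx1\<close>, opposite
    signs give the value \<open>- 2 * a1\<close>.\<close>
  have neg: "\<exists>x. adjacency_form G w x < 0"
    by (rule exI[of _ "(\<lambda>p. if p = Vu then 1 else if p = Vx1 then - 1 else 0) \<circ> f"])
      (use pos in \<open>simp add: form\<close>)
  \<comment> \<open>The coefficients of the linear factor in \<open>t Vu\<close> and
    \<open>t Vv\<close>.\<close>
  define q where "q p = (if p = Vu then a1 else if p = Vv then a2 else 0)" for p
  have nonneg: "adjacency_form G w x \<ge> 0" if qx: "(\<Sum>p\<in>pverts G. (q \<circ> f) p * x p) = 0" for x
  proof -
    \<comment> \<open>\<open>t\<close> carries \<open>x\<close> over to the theta graph;
      \<open>t \<circ> f\<close> agrees with \<open>x\<close> on the vertices, and the form depends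
      on nothing else.\<close>
    define t where "t = x \<circ> inv_into (pverts G) f"
    have tx: "t (f p) = x p" if "p \<in> pverts G" for p
      using that f by (simp add: t_def bij_betw_def inv_into_f_f)
    have "(\<Sum>p\<in>pverts G. (q \<circ> f) p * x p) = (\<Sum>p\<in>pverts G. q (f p) * t (f p))"
      by (simp add: tx cong: sum.cong)
    also have "\<dots> = (\<Sum>p\<in>pverts theta111. q p * t p)"
      by (simp add: sum.reindex_bij_betw[OF f, symmetric])
    also have "\<dots> = a1 * t Vu + a2 * t Vv" by (simp add: verts q_def)
    finally have 0: "a1 * t Vu + a2 * t Vv = 0" using qx by simp
    have "adjacency_form G w x = adjacency_form G w (t \<circ> f)"
      unfolding adjacency_form_def by (simp add: tx cong: sum.cong)
    \<comment> \<open>Multiplying by \<open>a1\<close> produces the products \<open>a1 * b2\<close>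
      and \<open>a1 * c2\<close>, which the weight equations rewrite without division.\<close>
    then have "a1 * adjacency_form G w x =
      2 * (t Vu * (a1 * (a1 * t Vx1 + b1 * t Vy1 + c1 * t Vz1)) +
        t Vv * (a2 * a1 * t Vx1 + (a1 * b2) * t Vy1 + (a1 * c2) * t Vz1))"
      unfolding form by (simp add: algebra_simps)
    also have "\<dots> = 2 * ((a1 * t Vu + a2 * t Vv) * (a1 * t Vx1 + b1 * t Vy1 + c1 * t Vz1))"
      unfolding rank1[symmetric] by (simp add: algebra_simps)
    finally have "a1 * adjacency_form G w x =
      2 * ((a1 * t Vu + a2 * t Vv) * (a1 * t Vx1 + b1 * t Vy1 + c1 * t Vz1))" .
    then have "adjacency_form G w x = 0" using 0 pos by simp
    then show ?thesis by simp
  qed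
  from neg nonneg show ?thesis unfolding neg_index_eq_1_iff[OF pair_graph] by blast
qed

theorem theorem4p2:
  fixes G :: "'a pair_pre_digraph" and w :: "'a set \<Rightarrow> real"
  assumes "weighted_graph G w" and "bicyclic G"
  shows "neg_index G w = 1 \<longleftrightarrow>
    (\<exists>a1 a2 b1 b2 c1 c2 :: real.
       a1 > 0 \<and> a2 > 0 \<and> b1 > 0 \<and> b2 > 0 \<and> c1 > 0 \<and> c2 > 0 \<and>
       c1 * a2 = a1 * c2 \<and> a2 * b1 = a1 * b2 \<and>
       weighted_iso G w theta111 (theta111_weight a1 a2 b1 b2 c1 c2))"
    (is "_ \<longleftrightarrow> ?theta")
proof -
  have "pair_graph G" using assms(2) by (simp add: bicyclic_def)
  then interpret weighted_pair_graph G w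
    using assms(1)
    by (simp add: weighted_pair_graph_def weighted_pair_graph_axioms_def weighted_graph_def)
  show ?thesis
  proof
    assume "neg_index G w = 1"
    then interpret neg_index_1_graph G w by unfold_locales
    show ?theta using assms(2) by (intro weighted_iso_theta111) (simp_all add: bicyclic_def)
  qed (use neg_index_eq_1_if_iso_theta111 in blast)
qed

end
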